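(* Let $G=(V,E)$ be an arbitrary finite network in which every node has at least one neighbor, let $\tau\in(0,1)$, let $f$ be a Type II combat-power function with threshold $\tau$, and let $(B_v(t))_{v\in V}$, $t\ge0$, be a solution of the Type II dynamics $$\frac{d}{dt}B_v(t)=f\Big(\frac{1}{\deg(v)}\sum_{u\in N_v}B_u(t)\Big)-B_v(t),\quad v\in V,$$ with values $B_v(t)\in[0,1]$. If $\frac{1}{\deg(v)}\sum_{u\in N_v}B_u(0)>\tau$ for all $v\in V$, then $\lim_{t\to\infty}B_v(t)=1$ for all $v\in V$. If $\frac{1}{\deg(v)}\sum_{u\in N_v}B_u(0)<\tau$ for all $v\in V$, then $\lim_{t\to\infty}B_v(t)=0$ for all $v\in V$.
   Context: $G=(V,E)$ is a finite graph (undirected or directed) without self-loops, $N_v=\{u\in V:(u,v)\in E\}$ is the set of (in-)neighbors of $v$, and $\deg(v)=|N_v|$. A Type II combat-power function with threshold $\tau\in(0,1)$ is a function $f:[0,1]\to[0,1]$ that is increasing, with $f(0)=0$, $f(\tau)=\tau$, $f(1)=1$; $f$ is continuous and convex on $[0,\tau)$ with $f(x)<x$ for $x\in(0,\tau)$; $f$ is continuous and concave on $(\tau,1]$ with $f(x)>x$ for $x\in(\tau,1)$; and $f$ is continuous and differentiable near $\tau$ (a sigmoid function). $B_v(t)\in[0,1]$ represents the probability that node $v$ is secure ("blue") at time $t$. *)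

theory Defs
  imports "HOL-Analysis.Analysis" "Graph_Theory.Pair_Digraph"
begin

text \<open>
  Networks are finite loop-free digraphs without parallel arcs (locale \<^locale>\<open>pair_digraph\<close>);
  an undirected network is one whose arc relation is symmetric.
\<close>

definition in_nbrs :: "'v pair_pre_digraph \<Rightarrow> 'v \<Rightarrow> 'v set" where
  "in_nbrs G v = {u \<in> pverts G. (u, v) \<in> parcs G}"

definition deg :: "'v pair_pre_digraph \<Rightarrow> 'v \<Rightarrow> nat" where
  "deg G v = card (in_nbrs G v)"

definition nbr_avg :: "'v pair_pre_digraph \<Rightarrow> ('v \<Rightarrow> real) \<Rightarrow> 'v \<Rightarrow> real" where
  "nbr_avg G b v = (1 / real (deg G v)) * (\<Sum>u\<in>in_nbrs G v. b u)"

text \<open>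
  Only the values of \<open>f\<close> on \<open>[0,1]\<close> matter: since \<open>0 < \<tau> < 1\<close>, the neighbourhood of \<open>\<tau>\<close> in the last
  two conditions can be taken inside \<open>(0,1)\<close>. ``Increasing'' is read in the non-strict sense.
\<close>

definition type_II_combat_power :: "real \<Rightarrow> (real \<Rightarrow> real) \<Rightarrow> bool" where
  "type_II_combat_power \<tau> f \<longleftrightarrow>
     0 < \<tau> \<and> \<tau> < 1 \<and>
     f \<in> {0..1} \<rightarrow> {0..1} \<and>
     mono_on {0..1} f \<and>
     f 0 = 0 \<and> f \<tau> = \<tau> \<and> f 1 = 1 \<and>
     continuous_on {0..<\<tau>} f \<and> convex_on {0..<\<tau>} f \<and> (\<forall>x\<in>{0<..<\<tau>}. f x < x) \<and>
     continuous_on {\<tau><..1} f \<and> concave_on {\<tau><..1} f \<and> (\<forall>x\<in>{\<tau><..<1}. f x > x) \<and>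
     (\<forall>\<^sub>F x in nhds \<tau>. isCont f x) \<and>
     (\<forall>\<^sub>F x in nhds \<tau>. f differentiable (at x))"

text \<open>
  Derivatives are taken within \<open>[0,\<infinity>)\<close>, hence one-sided at \<open>t = 0\<close> and two-sided for \<open>t > 0\<close>.
\<close>

definition type_II_solution ::
    "'v pair_pre_digraph \<Rightarrow> (real \<Rightarrow> real) \<Rightarrow> ('v \<Rightarrow> real \<Rightarrow> real) \<Rightarrow> bool" where
  "type_II_solution G f B \<longleftrightarrow>
     (\<forall>v\<in>pverts G. \<forall>t\<ge>0.
        (B v has_real_derivative f (nbr_avg G (\<lambda>u. B u t) v) - B v t) (at t within {0..}))"

end

theory Submission
  imports Defs
begin

text \<open>
  Put \<open>A v t = nbr_avg G (\<lambda>u. B u t) v\<close>. If all \<open>A u\<close> are at least \<open>c > \<tau>\<close>, then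
  monotonicity of \<open>f\<close> gives \<open>A v' \<ge> f c - A v\<close>, so \<open>A v\<close> relaxes exponentially to values at least
  \<open>f c\<close>, and \<open>f c > c\<close>. Hence a lower bound \<open>c > \<tau>\<close> that holds initially persists, and the
  supremum of the eventual lower bounds cannot lie below 1, because \<open>f\<close> is continuous and
  lies above the diagonal there. The same relaxation estimate carries the limit from \<open>A\<close> to \<open>B\<close>.
  The second claim is the first one for \<open>1 - B\<close>, which solves the system with
  \<open>x \<mapsto> 1 - f (1 - x)\<close> in place of \<open>f\<close> and threshold \<open>1 - \<tau>\<close>.
\<close>

section \<open>One-variable analysis: relaxation estimates and one-sided continuity\<close>

text \<open>Here \<open>g'\<close> is the forcing term, not the derivative of \<open>g\<close>. With
  the integrating factor \<open>exp t\<close>, the function \<open>exp t * (g t - c)\<close> has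
  derivative \<open>exp t * (g' t - c)\<close>, which is nonnegative between \<open>a\<close> and
  \<open>b\<close>. Asking for the bound only on the open interval allows a first exit time as
  \<open>b\<close>.\<close>

lemma relaxation_lower_bound:
  fixes g g' :: "real \<Rightarrow> real"
  assumes deriv: "\<And>t. 0 \<le> t \<Longrightarrow> (g has_real_derivative g' t - g t) (at t within {0..})"
    and lower: "\<And>t. a < t \<Longrightarrow> t < b \<Longrightarrow> c \<le> g' t"
    and "0 \<le> a" "a \<le> b"
  shows "c + exp (a - b) * (g a - c) \<le> g b"
proof -
  let ?h = "\<lambda>t. exp t * (g t - c)"
  have "?h a \<le> ?h b"
  proof (rule DERIV_nonneg_imp_increasing_open[OF \<open>a \<le> b\<close>])
    fix t assume t: "a < t" "t < b"
    have "at t within {0..} = at t"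
      using t \<open>0 \<le> a\<close> by (intro at_within_interior) auto
    then have "(g has_real_derivative g' t - g t) (at t)"
      using deriv[of t] t \<open>0 \<le> a\<close> by simp
    then have "(?h has_real_derivative exp t * (g' t - c)) (at t)"
      by (auto intro!: derivative_eq_intros simp: algebra_simps)
    moreover have "0 \<le> exp t * (g' t - c)"
      using lower[OF t] by simp
    ultimately show "\<exists>y. (?h has_real_derivative y) (at t) \<and> 0 \<le> y"
      by blast
  next
    have "continuous_on {0..} g"
      by (rule DERIV_continuous_on[OF deriv]) simp
    then have "continuous_on {a..b} g"
      using \<open>0 \<le> a\<close> by (rule_tac continuous_on_subset) auto
    then show "continuous_on {a..b} ?h"
      by (intro continuous_intros)
  qed
  then have "exp (-b) * ?h a \<le> exp (-b) * ?h b"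
    by (intro mult_left_mono) auto
  then have "exp (-b) * exp a * (g a - c) \<le> exp (-b) * exp b * (g b - c)"
    by (simp only: mult.assoc)
  then have "exp (a - b) * (g a - c) \<le> g b - c"
    by (simp flip: exp_add)
  then show ?thesis by simp
qed

lemma relaxation_eventually_above:
  fixes g g' :: "real \<Rightarrow> real"
  assumes deriv: "\<And>t. 0 \<le> t \<Longrightarrow> (g has_real_derivative g' t - g t) (at t within {0..})"
    and lower: "\<forall>\<^sub>F t in at_top. c \<le> g' t"
    and "d < c"
  shows "\<forall>\<^sub>F t in at_top. d < g t"
proof -
  obtain a0 where a0: "\<And>t. a0 \<le> t \<Longrightarrow> c \<le> g' t"
    using lower by (auto simp: eventually_at_top_linorder)
  define a where "a = max 0 a0"
  have "filterlim (\<lambda>t. - a + t) at_top at_top"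
    by (rule filterlim_tendsto_add_at_top[OF tendsto_const filterlim_ident])
  then have "filterlim (\<lambda>t. a - t) at_bot at_top"
    by (simp add: filterlim_uminus_at_bot)
  then have "((\<lambda>t. exp (a - t)) \<longlongrightarrow> 0) at_top"
    by (rule filterlim_compose[OF exp_at_bot])
  then have "((\<lambda>t. c + exp (a - t) * (g a - c)) \<longlongrightarrow> c + 0 * (g a - c)) at_top"
    by (intro tendsto_intros)
  then have "\<forall>\<^sub>F t in at_top. d < c + exp (a - t) * (g a - c)"
    using \<open>d < c\<close> by (intro order_tendstoD) auto
  moreover have "\<forall>\<^sub>F t in at_top. a \<le> t"
    by (rule eventually_ge_at_top)
  ultimately show ?thesis
  proof eventually_elim
    case (elim t)
    have "c + exp (a - t) * (g a - c) \<le> g t"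
      by (rule relaxation_lower_bound[OF deriv]) (use elim a0 in \<open>auto simp: a_def\<close>)
    with elim show ?case by linarith
  qed
qed

lemma continuous_on_gt_left_neighbourhood:
  fixes f :: "real \<Rightarrow> real"
  assumes "continuous_on {a<..<b} f" "a < l" "l < b" "y < f l"
  obtains c where "a < c" "c < l" "\<And>x. c < x \<Longrightarrow> x < l \<Longrightarrow> y < f x"
proof -
  have "isCont f l"
    using assms by (simp add: continuous_on_eq_continuous_at)
  then have "(f \<longlongrightarrow> f l) (at_left l)"
    by (simp add: isCont_def filterlim_at_split)
  then have "\<forall>\<^sub>F x in at_left l. y < f x"
    using \<open>y < f l\<close> by (rule order_tendstoD)
  then obtain c where c: "c < l" "\<And>x. c < x \<Longrightarrow> x < l \<Longrightarrow> y < f x"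
    using \<open>a < l\<close> by (auto simp: eventually_at_left)
  \<comment> \<open>The \<open>c\<close> obtained from the filter may lie below \<open>a\<close>;
    the midpoint lies strictly between both and \<open>l\<close>.\<close>
  let ?m = "(max a c + l) / 2"
  show thesis
    by (rule that[of ?m]) (use c \<open>a < l\<close> in \<open>auto simp: max_def field_simps split: if_splits\<close>)
qed

section \<open>Neighbourhood averages in the supercritical system\<close>

lemma in_nbrs_subset: "in_nbrs G v \<subseteq> pverts G"
  by (auto simp: in_nbrs_def)

text \<open>The assumptions on \<open>f\<close> describe monotonicity and the behaviour above the
  threshold, so that both \<open>f\<close> and its reflection \<open>1 - f (1 - x)\<close> can
  instantiate them.\<close>

locale supercritical_dynamics =
  pair_digraph G for G :: "'v pair_pre_digraph" +
  fixes \<tau> :: real and f :: "real \<Rightarrow> real" and B :: "'v \<Rightarrow> real \<Rightarrow> real"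
  assumes nbrs_nonempty: "v \<in> pverts G \<Longrightarrow> in_nbrs G v \<noteq> {}"
    and threshold_nonneg: "0 \<le> \<tau>"
    and mono: "mono_on {0..1} f"
    and above_diagonal: "\<tau> < x \<Longrightarrow> x < 1 \<Longrightarrow> x < f x"
    and cont: "continuous_on {\<tau><..<1} f"
    and solution: "type_II_solution G f B"
    and range: "v \<in> pverts G \<Longrightarrow> 0 \<le> t \<Longrightarrow> B v t \<in> {0..1}"
begin

lemma finite_in_nbrs: "finite (in_nbrs G v)"
  by (rule finite_subset[OF in_nbrs_subset finite_verts])

lemma deg_pos: "v \<in> pverts G \<Longrightarrow> 0 < deg G v"
  by (simp add: deg_def card_gt_0_iff finite_in_nbrs nbrs_nonempty)

lemma nbr_avg_ge:
  assumes "v \<in> pverts G" "\<And>u. u \<in> pverts G \<Longrightarrow> c \<le> b u"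
  shows "c \<le> nbr_avg G b v"
proof -
  have "real (deg G v) * c \<le> sum b (in_nbrs G v)"
    unfolding deg_def by (rule sum_bounded_below) (use assms in_nbrs_subset[of G v] in blast)
  then show ?thesis
    using deg_pos[OF assms(1)] by (simp add: nbr_avg_def field_simps)
qed

lemma nbr_avg_uminus: "nbr_avg G (\<lambda>u. - b u) v = - nbr_avg G b v"
  by (simp add: nbr_avg_def sum_negf)

lemma nbr_avg_one_minus:
  "v \<in> pverts G \<Longrightarrow> nbr_avg G (\<lambda>u. 1 - b u) v = 1 - nbr_avg G b v"
  using deg_pos[of v] by (simp add: nbr_avg_def sum_subtractf deg_def field_simps)

abbreviation A :: "'v \<Rightarrow> real \<Rightarrow> real" where
  "A v t \<equiv> nbr_avg G (\<lambda>u. B u t) v"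

lemma deriv_B:
  "v \<in> pverts G \<Longrightarrow> 0 \<le> t \<Longrightarrow> (B v has_real_derivative f (A v t) - B v t) (at t within {0..})"
  using solution by (simp add: type_II_solution_def)

text \<open>Averaging is linear, so each average again solves a relaxation equation, now forced by
  the averaged values of \<open>f\<close>.\<close>

lemma deriv_A:
  assumes "0 \<le> t"
  shows "(A v has_real_derivative nbr_avg G (\<lambda>u. f (A u t)) v - A v t) (at t within {0..})"
proof -
  have "((\<lambda>t. \<Sum>u\<in>in_nbrs G v. B u t) has_real_derivative
      (\<Sum>u\<in>in_nbrs G v. f (A u t) - B u t)) (at t within {0..})"
    using assms in_nbrs_subset[of G v] by (intro DERIV_sum deriv_B) auto
  from DERIV_cmult[OF this, of "1 / real (deg G v)"] show ?thesis
    unfolding nbr_avg_def sum_subtractf right_diff_distrib .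
qed

lemma A_le_1:
  assumes "v \<in> pverts G" "0 \<le> t"
  shows "A v t \<le> 1"
  using nbr_avg_ge[of v "-1" "\<lambda>u. - B u t"] range assms by (simp add: nbr_avg_uminus)

lemma f_A_ge:
  assumes "v \<in> pverts G" "0 \<le> t" "\<tau> < c" "c \<le> A v t"
  shows "f c \<le> f (A v t)"
  using assms A_le_1[of v t] threshold_nonneg by (intro mono_onD[OF mono]) auto

text \<open>First-exit argument: \<open>Inf S\<close> is the first time at which some average is at
  most \<open>c\<close>. Before it all averages exceed \<open>c\<close>, so the forcing is at least
  \<open>f c > c\<close>, and the relaxation estimate from time 0 keeps a strictly positive gap at
  \<open>Inf S\<close>.\<close>

lemma lower_bound_persists:
  assumes c: "\<tau> < c" "c < 1" and init: "\<And>v. v \<in> pverts G \<Longrightarrow> c < A v 0"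
    and v: "v \<in> pverts G" and "0 \<le> t"
  shows "c < A v t"
proof (rule ccontr)
  assume "\<not> c < A v t"
  define S where "S = (\<Union>v\<in>pverts G. {0..} \<inter> A v -` {..c})"
  have "continuous_on {0..} (A w)" for w
    by (rule DERIV_continuous_on[OF deriv_A]) simp
  then have "closed S"
    unfolding S_def by (intro closed_UN finite_verts ballI continuous_closed_preimage) auto
  moreover have "t \<in> S"
    using \<open>\<not> c < A v t\<close> v \<open>0 \<le> t\<close> by (auto simp: S_def not_less)
  moreover have bdd: "bdd_below S"
    by (auto simp: S_def intro!: bdd_belowI[of _ 0])
  ultimately have "Inf S \<in> S"
    by (intro closed_contains_Inf) auto
  then obtain w where w: "w \<in> pverts G" "0 \<le> Inf S" "A w (Inf S) \<le> c"
    by (auto simp: S_def)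
  have before: "c < A u s" if "u \<in> pverts G" "0 \<le> s" "s < Inf S" for u s
    using that cInf_lower[OF _ bdd, of s] by (force simp: S_def)
  have "c + exp (0 - Inf S) * (A w 0 - c) \<le> A w (Inf S)"
  proof (rule relaxation_lower_bound[OF deriv_A])
    fix s assume s: "0 < s" "s < Inf S"
    show "c \<le> nbr_avg G (\<lambda>u. f (A u s)) w"
    proof (rule nbr_avg_ge[OF w(1)])
      fix u assume u: "u \<in> pverts G"
      have "f c \<le> f (A u s)"
        using before[OF u, of s] s by (intro f_A_ge u c) auto
      with above_diagonal[OF c] show "c \<le> f (A u s)" by simp
    qed
  qed (use w in auto)
  moreover have "0 < exp (0 - Inf S) * (A w 0 - c)"
    using init[OF w(1)] by simp
  ultimately show False
    using w(3) by linarith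
qed

section \<open>Eventual lower bounds and convergence to 1\<close>

definition eventual_bound :: "real \<Rightarrow> bool" where
  "eventual_bound c \<longleftrightarrow> (\<forall>v\<in>pverts G. \<forall>\<^sub>F t in at_top. c \<le> A v t)"

lemma eventually_f_A_ge:
  assumes "eventual_bound c" "\<tau> < c" "v \<in> pverts G"
  shows "\<forall>\<^sub>F t in at_top. f c \<le> f (A v t)"
proof -
  have "\<forall>\<^sub>F t in at_top. c \<le> A v t"
    using assms by (auto simp: eventual_bound_def)
  then show ?thesis
    using eventually_ge_at_top[of 0] by eventually_elim (rule f_A_ge[OF assms(3) _ assms(2)])
qed

text \<open>The inequality \<open>d < f c\<close> is strict because relaxation need only approach
  \<open>f c\<close>.\<close>

lemma eventual_bound_improves:
  assumes "eventual_bound c" "\<tau> < c" "d < f c"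
  shows "eventual_bound d"
  unfolding eventual_bound_def
proof
  fix v assume v: "v \<in> pverts G"
  \<comment> \<open>Finiteness of the vertex set gives one time that works for all nodes.\<close>
  have "\<forall>\<^sub>F t in at_top. \<forall>u\<in>pverts G. f c \<le> f (A u t)"
    using eventually_f_A_ge[OF assms(1,2)] by (simp add: eventually_ball_finite_distrib)
  then have lower: "\<forall>\<^sub>F t in at_top. f c \<le> nbr_avg G (\<lambda>u. f (A u t)) v"
    by (rule eventually_mono) (simp add: nbr_avg_ge v)
  have "\<forall>\<^sub>F t in at_top. d < A v t"
    by (rule relaxation_eventually_above[OF deriv_A lower assms(3)])
  then show "\<forall>\<^sub>F t in at_top. d \<le> A v t"
    by (rule eventually_mono) (rule less_imp_le)
qed

lemma eventual_bound_antimono: "eventual_bound c \<Longrightarrow> d \<le> c \<Longrightarrow> eventual_bound d"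
  unfolding eventual_bound_def by (rule ballI, drule (1) bspec, erule eventually_mono) simp

lemma eventual_bound_le_1:
  assumes "eventual_bound c" "pverts G \<noteq> {}"
  shows "c \<le> 1"
proof -
  obtain v where v: "v \<in> pverts G" using assms by blast
  then have "\<forall>\<^sub>F t in at_top. c \<le> A v t"
    using assms by (auto simp: eventual_bound_def)
  then have "\<forall>\<^sub>F t in at_top. c \<le> A v t \<and> 0 \<le> t"
    by (intro eventually_conj eventually_ge_at_top)
  then obtain t where "c \<le> A v t" "0 \<le> t"
    using eventually_happens'[OF trivial_limit_at_top_linorder] by blast
  then show ?thesis
    using A_le_1[OF v] by force
qed

lemma eventual_bound_below_1:
  assumes c: "eventual_bound c" "\<tau> < c" and "d < 1" and "pverts G \<noteq> {}"
  shows "eventual_bound d"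
proof (rule ccontr)
  assume "\<not> eventual_bound d"
  let ?S = "Collect eventual_bound"
  define l where "l = Sup ?S"
  have bdd: "bdd_above ?S"
    using eventual_bound_le_1[OF _ \<open>pverts G \<noteq> {}\<close>] by (intro bdd_aboveI[of _ 1]) auto
  have "l \<le> d"
    unfolding l_def
  proof (rule cSup_least)
    show "?S \<noteq> {}" using c by blast
    show "x \<le> d" if "x \<in> ?S" for x
      using that eventual_bound_antimono[of x d] \<open>\<not> eventual_bound d\<close> by force
  qed
  have "c \<le> l"
    unfolding l_def by (rule cSup_upper[OF _ bdd]) (simp add: c)
  then have l: "\<tau> < l" "l < 1"
    using \<open>\<tau> < c\<close> \<open>l \<le> d\<close> \<open>d < 1\<close> by auto
  \<comment> \<open>The supremum \<open>l\<close> need not itself be an eventual bound. Continuity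
    provides points \<open>x < l\<close> with \<open>f x > l\<close>; such an \<open>x\<close> is an
    eventual bound, and improving it overshoots \<open>l\<close>.\<close>
  obtain e where e: "\<tau> < e" "e < l" "\<And>x. e < x \<Longrightarrow> x < l \<Longrightarrow> l < f x"
    using continuous_on_gt_left_neighbourhood[OF cont l above_diagonal[OF l]] by blast
  define x where "x = (e + l) / 2"
  have x: "e < x" "x < l"
    using e by (auto simp: x_def)
  obtain s where "eventual_bound s" "x < s"
    using less_cSupD[of ?S x] x c by (auto simp: l_def)
  then have "eventual_bound x"
    using eventual_bound_antimono[of s x] by simp
  moreover obtain y where y: "l < y" "y < f x"
    using e(3)[OF x] dense by blast
  moreover have "\<tau> < x"
    using x e by linarith
  ultimately have "eventual_bound y"
    using eventual_bound_improves by blast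
  then have "y \<le> l"
    unfolding l_def by (intro cSup_upper[OF _ bdd]) auto
  with y show False by simp
qed

theorem tendsto_1:
  assumes init: "\<And>v. v \<in> pverts G \<Longrightarrow> \<tau> < A v 0" and v: "v \<in> pverts G"
  shows "(B v \<longlongrightarrow> 1) at_top"
proof (rule order_tendstoI)
  have ne: "pverts G \<noteq> {}"
    using v by blast
  \<comment> \<open>The minimum over finitely many nodes turns the strict initial inequalities into
    one margin above \<tau>.\<close>
  define m where "m = Min ((\<lambda>u. A u 0) ` pverts G)"
  have m: "m \<le> A u 0" if "u \<in> pverts G" for u
    using that by (auto simp: m_def finite_verts)
  have "\<tau> < m"
    using init ne by (auto simp: m_def finite_verts)
  moreover have "m \<le> 1"
    using m[OF v] A_le_1[OF v, of 0] by simp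
  ultimately obtain c where c: "\<tau> < c" "c < m" "c < 1"
    using dense[of \<tau> m] by fastforce
  have "c < A u t" if "u \<in> pverts G" "0 \<le> t" for u t
    by (rule lower_bound_persists[OF c(1,3) less_le_trans[OF c(2) m] that])
  then have bound: "eventual_bound c"
    unfolding eventual_bound_def
    by (intro ballI eventually_mono[OF eventually_ge_at_top[of 0]] less_imp_le)
  fix d :: real assume "d < 1"
  \<comment> \<open>Taking \<open>e\<close> above \<tau> as well as \<open>d\<close> yields
    \<open>d < e < f e\<close>.\<close>
  then obtain e where e: "max d \<tau> < e" "e < 1"
    using c dense[of "max d \<tau>" 1] by auto
  then have "eventual_bound e"
    using eventual_bound_below_1[OF bound c(1) _ ne] by simp
  then have "\<forall>\<^sub>F t in at_top. f e \<le> f (A v t)"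
    using e v by (intro eventually_f_A_ge) auto
  moreover have "d < f e"
    using above_diagonal[of e] e by simp
  ultimately show "\<forall>\<^sub>F t in at_top. d < B v t"
    by (intro relaxation_eventually_above[OF deriv_B[OF v]])
next
  fix d :: real assume "1 < d"
  then show "\<forall>\<^sub>F t in at_top. B v t < d"
    by (intro eventually_mono[OF eventually_ge_at_top[of 0]] le_less_trans[of "B v _" 1 d])
      (use range[OF v] in auto)
qed

end

section \<open>The two limits, by interpretation and reflection\<close>

theorem theorem5:
  fixes G :: "'v pair_pre_digraph"
    and \<tau> :: real
    and f :: "real \<Rightarrow> real"
    and B :: "'v \<Rightarrow> real \<Rightarrow> real"
  assumes "pair_digraph G"
    and "\<forall>v\<in>pverts G. in_nbrs G v \<noteq> {}"
    and "0 < \<tau>" and "\<tau> < 1"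
    and "type_II_combat_power \<tau> f"
    and "type_II_solution G f B"
    and "\<forall>v\<in>pverts G. \<forall>t\<ge>0. B v t \<in> {0..1}"
  shows "((\<forall>v\<in>pverts G. nbr_avg G (\<lambda>u. B u 0) v > \<tau>) \<longrightarrow>
            (\<forall>v\<in>pverts G. (B v \<longlongrightarrow> 1) at_top)) \<and>
         ((\<forall>v\<in>pverts G. nbr_avg G (\<lambda>u. B u 0) v < \<tau>) \<longrightarrow>
            (\<forall>v\<in>pverts G. (B v \<longlongrightarrow> 0) at_top))"
proof (intro conjI impI ballI)
  interpret pair_digraph G by fact
  have mono: "mono_on {0..1} f"
    and above: "\<And>x. \<tau> < x \<Longrightarrow> x < 1 \<Longrightarrow> x < f x"
    and below: "\<And>x. 0 < x \<Longrightarrow> x < \<tau> \<Longrightarrow> f x < x"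
    and cont: "continuous_on {0..<\<tau>} f" "continuous_on {\<tau><..1} f"
    using assms(5) by (auto simp: type_II_combat_power_def)
  interpret blue: supercritical_dynamics G \<tau> f B
    by unfold_locales
      (use assms mono above in \<open>auto intro: continuous_on_subset[OF cont(2)]\<close>)
  fix v assume v: "v \<in> pverts G"
  {
    assume "\<forall>v\<in>pverts G. nbr_avg G (\<lambda>u. B u 0) v > \<tau>"
    then show "(B v \<longlongrightarrow> 1) at_top"
      using v by (intro blue.tendsto_1) auto
  next
    assume init: "\<forall>v\<in>pverts G. nbr_avg G (\<lambda>u. B u 0) v < \<tau>"
    \<comment> \<open>Averages commute with \<open>1 - _\<close> because degrees are positive, so
      the reflected right-hand side is \<open>-(f A - B)\<close>, the derivative of
      \<open>1 - B\<close>. The region below \<tau> becomes the one above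
      \<open>1 - \<tau>\<close>.\<close>
    interpret red: supercritical_dynamics G "1 - \<tau>" "\<lambda>x. 1 - f (1 - x)" "\<lambda>u t. 1 - B u t"
    proof unfold_locales
      show "mono_on {0..1} (\<lambda>x. 1 - f (1 - x))"
        by (auto intro!: mono_onI mono_onD[OF mono])
      show "continuous_on {1 - \<tau><..<1} (\<lambda>x. 1 - f (1 - x))"
        by (intro continuous_intros continuous_on_compose2[OF cont(1)]) auto
      show "x < 1 - f (1 - x)" if "1 - \<tau> < x" "x < 1" for x
        using below[of "1 - x"] that by simp
      show "type_II_solution G (\<lambda>x. 1 - f (1 - x)) (\<lambda>u t. 1 - B u t)"
        unfolding type_II_solution_def
        by (auto simp: blue.nbr_avg_one_minus intro!: derivative_eq_intros blue.deriv_B)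
    qed (use assms in auto)
    have "((\<lambda>t. 1 - B v t) \<longlongrightarrow> 1) at_top"
      using v init by (intro red.tendsto_1) (auto simp: blue.nbr_avg_one_minus)
    from tendsto_diff[OF tendsto_const[of 1] this] show "(B v \<longlongrightarrow> 0) at_top"
      by simp
  }
qed

end
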